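(* Let $R_1,R_2\in SO(3)$ and $x\in U_{R_1}\cap U_{R_2}$. Then $\omega_{R_2,R_1}(x)=-\psi_{R_2,R_1}(x)$ (equality of angles modulo $2\pi$).
   Context: Let $x_0,x_1$ be the north and south poles of $\mathbb S^2\subset\mathbb R^3$ (on the $z$ axis), $U_e=\mathbb S^2\setminus\{x_0,x_1\}$ and $U_R=RU_e$ for $R\in SO(3)$. Every rotation $R$ is the composition of a rotation by an angle $\gamma_R$ around the $z$ axis, followed by a rotation by $\beta_R$ around the $y$ axis, followed by a rotation by $\alpha_R$ around the $z$ axis (Euler angles, z-y-z convention). For $y\in U_e$ let $g_y\in SO(3)$ be the unique rotation with $g_yx_0=y$ and third Euler angle $\gamma_{g_y}=0$ (so $(\beta_{g_y},\alpha_{g_y})$ are the colatitude and longitude of $y$). For $x\in U_{R_1}\cap U_{R_2}$ set $$k_{R_2,R_1}(x)=(g_{R_2^{-1}x})^{-1}R_2^{-1}R_1\,g_{R_1^{-1}x},$$ which fixes $x_0$, hence is a rotation around the $z$ axis; $\omega_{R_2,R_1}(x)$ is its (oriented, counterclockwise) rotation angle. For $x\in U_e$ let $\rho(x)=\frac1{\sqrt{x_1^2+x_2^2}}(-x_2,x_1,0)$ (in coordinates $x=(x_1,x_2,x_3)$) be the unit tangent vector at $x$ tangent to the parallel through $x$ and pointing in the direction of increasing longitude, and for $x\in U_R$ let $\rho_R(x)=R\rho(R^{-1}x)$. For $x\in U_{R_1}\cap U_{R_2}$, $\psi_{R_2,R_1}(x)$ is the oriented angle in the tangent plane at $x$ (oriented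 by the outward normal, i.e. counterclockwise as seen from outside the sphere) from $\rho_{R_1}(x)$ to $\rho_{R_2}(x)$. *)

theory Defs
  imports "HOL-Analysis.Analysis" "HOL-Library.Real_Mod"
begin

definition north_pole :: "real^3" where
  "north_pole = vector [0, 0, 1]"

definition south_pole :: "real^3" where
  "south_pole = vector [0, 0, -1]"

definition U_e :: "(real^3) set" where
  "U_e = sphere 0 1 - {north_pole, south_pole}"

definition U :: "real^3^3 \<Rightarrow> (real^3) set" where
  "U R = (\<lambda>x. R *v x) ` U_e"

text \<open>
  Counterclockwise (right-handed) rotations about the z and the y axis. The sign of
  \<open>rot_y\<close> is such that \<open>rot_z \<alpha> ** rot_y \<beta>\<close> takes the north pole to the point of
  colatitude \<open>\<beta>\<close> and longitude \<open>\<alpha>\<close>.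
\<close>

definition rot_z :: "real \<Rightarrow> real^3^3" where
  "rot_z a = vector [vector [cos a, - sin a, 0],
                     vector [sin a,   cos a, 0],
                     vector [    0,       0, 1]]"

definition rot_y :: "real \<Rightarrow> real^3^3" where
  "rot_y b = vector [vector [  cos b, 0, sin b],
                     vector [      0, 1,     0],
                     vector [- sin b, 0, cos b]]"

text \<open>
  Euler angles in the z-y-z convention; the rotation by \<open>\<gamma>\<close>, the third Euler angle, is
  applied first. Without the range of \<open>\<beta>\<close>, the pair \<open>(\<alpha> + pi, - \<beta>)\<close> would describe a
  second rotation with \<open>\<gamma> = 0\<close> and the same image of the north pole as \<open>(\<alpha>, \<beta>)\<close>.
\<close>

definition euler_angles :: "real^3^3 \<Rightarrow> real \<Rightarrow> real \<Rightarrow> real \<Rightarrow> bool" where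
  "euler_angles R \<alpha> \<beta> \<gamma> \<longleftrightarrow>
     \<alpha> \<in> {0..<2*pi} \<and> \<beta> \<in> {0..pi} \<and> \<gamma> \<in> {0..<2*pi} \<and>
     R = rot_z \<alpha> ** rot_y \<beta> ** rot_z \<gamma>"

text \<open>
  The definite descriptions \<open>g\<close>, \<open>z_rotation_angle\<close> and \<open>oriented_angle\<close> are meant for
  \<open>y \<in> U_e\<close>, for rotations about the z axis, and for nonzero vectors \<open>u\<close>, \<open>v\<close> orthogonal to
  the unit vector \<open>n\<close>, respectively. Angles are represented in \<open>[0, 2 pi)\<close>.
\<close>

definition g :: "real^3 \<Rightarrow> real^3^3" where
  "g y = (THE Q. rotation_matrix Q \<and> Q *v north_pole = y \<and> (\<exists>\<alpha> \<beta>. euler_angles Q \<alpha> \<beta> 0))"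

definition k :: "real^3^3 \<Rightarrow> real^3^3 \<Rightarrow> real^3 \<Rightarrow> real^3^3" where
  "k R2 R1 x =
     matrix_inv (g (matrix_inv R2 *v x)) ** matrix_inv R2 ** R1 ** g (matrix_inv R1 *v x)"

definition z_rotation_angle :: "real^3^3 \<Rightarrow> real" where
  "z_rotation_angle Q = (THE a. a \<in> {0..<2*pi} \<and> Q = rot_z a)"

definition \<omega> :: "real^3^3 \<Rightarrow> real^3^3 \<Rightarrow> real^3 \<Rightarrow> real" where
  "\<omega> R2 R1 x = z_rotation_angle (k R2 R1 x)"

definition rho_e :: "real^3 \<Rightarrow> real^3" where
  "rho_e x = (1 / sqrt ((x$1)\<^sup>2 + (x$2)\<^sup>2)) *\<^sub>R vector [- x$2, x$1, 0]"

definition rho :: "real^3^3 \<Rightarrow> real^3 \<Rightarrow> real^3" where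
  "rho R x = R *v rho_e (matrix_inv R *v x)"

text \<open>
  The angle from \<open>u\<close> to \<open>v\<close> in the plane orthogonal to \<open>n\<close>, counterclockwise as seen from
  the tip of \<open>n\<close>: \<open>(sgn u, cross3 n (sgn u))\<close> is a positively oriented orthonormal basis of
  that plane.
\<close>

definition oriented_angle :: "real^3 \<Rightarrow> real^3 \<Rightarrow> real^3 \<Rightarrow> real" where
  "oriented_angle n u v =
     (THE a. a \<in> {0..<2*pi} \<and> sgn v = cos a *\<^sub>R sgn u + sin a *\<^sub>R cross3 n (sgn u))"

definition \<psi> :: "real^3^3 \<Rightarrow> real^3^3 \<Rightarrow> real^3 \<Rightarrow> real" where
  "\<psi> R2 R1 x = oriented_angle x (rho R1 x) (rho R2 x)"

end

theory Submission
  imports Defs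
begin

text \<open>
  For \<open>y \<in> U_e\<close>, the rotation \<open>g y\<close> maps \<open>e\<^sub>3\<close> to \<open>y\<close> and \<open>e\<^sub>2\<close> to \<open>rho_e y\<close>. Hence
  \<open>A\<^sub>i = R\<^sub>i g(R\<^sub>i\<^sup>-\<^sup>1 x)\<close> maps \<open>e\<^sub>3\<close> to \<open>x\<close> and \<open>e\<^sub>2\<close> to \<open>rho R\<^sub>i x\<close>, while
  \<open>k R\<^sub>2 R\<^sub>1 x = A\<^sub>2\<^sup>-\<^sup>1 A\<^sub>1\<close>. So \<open>A\<^sub>2 = A\<^sub>1 rot_z (- \<omega>)\<close>, and applying this to \<open>e\<^sub>2\<close> shows that
  \<open>rho R\<^sub>2 x\<close> arises from \<open>rho R\<^sub>1 x\<close> by a rotation through \<open>- \<omega>\<close> about \<open>x\<close>.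
\<close>

unbundle cross3_syntax

section \<open>Inverses and products of rotation matrices\<close>

lemma matrix_inv_orthogonal:
  fixes A :: "real^'n^'n"
  assumes "orthogonal_matrix A"
  shows "matrix_inv A = transpose A"
proof -
  have A: "A ** transpose A = mat 1" "transpose A ** A = mat 1"
    using assms by (auto simp: orthogonal_matrix_def)
  \<comment> \<open>\<open>matrix_inv\<close> is a choice among two-sided inverses;
    \<open>transpose A\<close> witnesses that there is one.\<close>
  then have inv: "A ** matrix_inv A = mat 1 \<and> matrix_inv A ** A = mat 1"
    unfolding matrix_inv_def
    by (intro someI[where P = "\<lambda>B. A ** B = mat 1 \<and> B ** A = mat 1"] conjI)
  have "matrix_inv A = (transpose A ** A) ** matrix_inv A"
    using A by simp
  also have "\<dots> = transpose A ** (A ** matrix_inv A)"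
    by (simp only: matrix_mul_assoc)
  finally show ?thesis
    using inv by simp
qed

lemma matrix_inv_rotation_U:
  assumes R: "rotation_matrix R" and x: "x \<in> U R"
  shows "matrix_inv R *v x \<in> U_e" "R *v (matrix_inv R *v x) = x"
proof -
  have inv: "matrix_inv R ** R = mat 1"
    using R by (simp add: rotation_matrix_def matrix_inv_orthogonal orthogonal_matrix_def)
  obtain y where y: "y \<in> U_e" "x = R *v y"
    using x by (auto simp: U_def)
  have "matrix_inv R *v x = y"
    unfolding y(2) by (simp add: matrix_vector_mul_assoc inv)
  with y show "matrix_inv R *v x \<in> U_e" "R *v (matrix_inv R *v x) = x"
    by simp_all
qed

lemma rotation_matrix_mul:
  fixes A B :: "real^'n^'n"
  assumes "rotation_matrix A" "rotation_matrix B"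
  shows "rotation_matrix (A ** B)"
  using assms by (simp add: rotation_matrix_def orthogonal_matrix_mul det_mul)

lemma rotation_matrix_transpose: "rotation_matrix A \<Longrightarrow> rotation_matrix (transpose A)"
  by (simp add: rotation_matrix_def)

section \<open>Elementary rotations about the z and y axes\<close>

lemma rotation_rot_z: "rotation_matrix (rot_z a)"
proof -
  have "transpose (rot_z a) ** rot_z a = mat 1"
    by (simp add: vec_eq_iff forall_3 rot_z_def matrix_matrix_mult_def transpose_def mat_def sum_3
        flip: power2_eq_square)
  then show ?thesis
    by (simp add: rotation_matrix_def orthogonal_matrix det_3 rot_z_def flip: power2_eq_square)
qed

lemma rotation_rot_y: "rotation_matrix (rot_y a)"
proof -
  have "transpose (rot_y a) ** rot_y a = mat 1"
    by (simp add: vec_eq_iff forall_3 rot_y_def matrix_matrix_mult_def transpose_def mat_def sum_3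
        flip: power2_eq_square)
  then show ?thesis
    by (simp add: rotation_matrix_def orthogonal_matrix det_3 rot_y_def flip: power2_eq_square)
qed

lemma rot_z_0: "rot_z 0 = mat 1"
  by (simp add: vec_eq_iff forall_3 rot_z_def mat_def)

lemma north_pole_eq_axis: "north_pole = axis 3 1"
  by (simp add: vec_eq_iff forall_3 north_pole_def axis_def)

section \<open>Spherical coordinates and the columns of \<open>g y\<close>\<close>

lemma rot_zy_north_pole:
  "(rot_z \<alpha> ** rot_y \<beta>) *v north_pole = vector [sin \<beta> * cos \<alpha>, sin \<beta> * sin \<alpha>, cos \<beta>]"
  by (simp add: vec_eq_iff forall_3 rot_z_def rot_y_def north_pole_def matrix_matrix_mult_def
      matrix_vector_mult_def sum_3)

lemma rot_zy_axis_2: "(rot_z \<alpha> ** rot_y \<beta>) *v axis 2 1 = vector [- sin \<alpha>, cos \<alpha>, 0]"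
  by (simp add: vec_eq_iff forall_3 rot_z_def rot_y_def axis_def matrix_matrix_mult_def
      matrix_vector_mult_def sum_3)

text \<open>The distance \<open>s\<close> of \<open>y\<close> from the z axis is positive because
  the poles are excluded. The pair \<open>(y$3, s)\<close> lies on the upper half of the unit circle
  and yields the colatitude; the first two coordinates divided by \<open>s\<close> lie on the unit
  circle and yield the longitude.\<close>

lemma U_e_spherical_coordinates:
  assumes "y \<in> U_e"
  obtains \<alpha> \<beta> where "0 \<le> \<alpha>" "\<alpha> < 2 * pi" "0 \<le> \<beta>" "\<beta> \<le> pi" "sin \<beta> > 0"
    "y = vector [sin \<beta> * cos \<alpha>, sin \<beta> * sin \<alpha>, cos \<beta>]"
proof -
  define s where "s = sqrt ((y$1)\<^sup>2 + (y$2)\<^sup>2)"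
  have "norm y = 1" using assms by (simp add: U_e_def)
  then have norm: "(y$1)\<^sup>2 + (y$2)\<^sup>2 + (y$3)\<^sup>2 = 1"
    by (simp add: norm_vec_def L2_set_def sum_3)
  have "(y$1)\<^sup>2 + (y$2)\<^sup>2 \<noteq> 0"
  proof
    assume "(y$1)\<^sup>2 + (y$2)\<^sup>2 = 0"
    then have "y$1 = 0" "y$2 = 0" by simp_all
    moreover from this norm have "y$3 = 1 \<or> y$3 = -1" by (simp add: power2_eq_1_iff)
    ultimately have "y = north_pole \<or> y = south_pole"
      by (auto simp: vec_eq_iff forall_3 north_pole_def south_pole_def)
    with assms show False by (simp add: U_e_def)
  qed
  then have s: "s > 0" "s\<^sup>2 = (y$1)\<^sup>2 + (y$2)\<^sup>2"
    unfolding s_def by (auto simp: less_le simp del: sum_power2_eq_zero_iff)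
  have "(y$1 / s)\<^sup>2 + (y$2 / s)\<^sup>2 = 1"
    using s(1) by (simp add: power_divide del: sum_power2_eq_zero_iff flip: add_divide_distrib s(2))
  then obtain \<alpha> where \<alpha>: "0 \<le> \<alpha>" "\<alpha> < 2 * pi" "y$1 / s = cos \<alpha>" "y$2 / s = sin \<alpha>"
    by (rule sincos_total_2pi)
  have "(y$3)\<^sup>2 + s\<^sup>2 = 1" using norm s by simp
  then obtain \<beta> where \<beta>: "0 \<le> \<beta>" "\<beta> \<le> pi" "y$3 = cos \<beta>" "s = sin \<beta>"
    using sincos_total_pi s by (metis less_imp_le)
  have "y$1 = sin \<beta> * cos \<alpha>" "y$2 = sin \<beta> * sin \<alpha>"
    using \<alpha> \<beta> s by (auto simp: field_simps)
  then have "y = vector [sin \<beta> * cos \<alpha>, sin \<beta> * sin \<alpha>, cos \<beta>]"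
    using \<beta> by (simp add: vec_eq_iff forall_3)
  with that \<alpha> \<beta> s show ?thesis by blast
qed

text \<open>The Euler angles are recovered from the image of the north pole: cosine is injective on
  \<open>[0, pi]\<close>, which fixes the colatitude, and cancelling its nonzero sine fixes cosine
  and sine of the longitude. So the definite description in \<open>g\<close> has exactly one
  solution.\<close>

lemma g_spherical_coordinates:
  assumes "0 \<le> \<alpha>" "\<alpha> < 2 * pi" "0 \<le> \<beta>" "\<beta> \<le> pi" "sin \<beta> > 0"
  shows "g (vector [sin \<beta> * cos \<alpha>, sin \<beta> * sin \<alpha>, cos \<beta>]) = rot_z \<alpha> ** rot_y \<beta>"
  unfolding g_def
proof (rule the_equality)
  show "rotation_matrix (rot_z \<alpha> ** rot_y \<beta>) \<and>
    (rot_z \<alpha> ** rot_y \<beta>) *v north_pole = vector [sin \<beta> * cos \<alpha>, sin \<beta> * sin \<alpha>, cos \<beta>] \<and>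
    (\<exists>\<alpha>' \<beta>'. euler_angles (rot_z \<alpha> ** rot_y \<beta>) \<alpha>' \<beta>' 0)"
    using assms by (auto simp: euler_angles_def rot_z_0 rot_zy_north_pole rotation_matrix_mul
        rotation_rot_z rotation_rot_y)
next
  fix Q
  assume Q: "rotation_matrix Q \<and> Q *v north_pole = vector [sin \<beta> * cos \<alpha>, sin \<beta> * sin \<alpha>, cos \<beta>]
    \<and> (\<exists>\<alpha>' \<beta>'. euler_angles Q \<alpha>' \<beta>' 0)"
  then obtain a b where ab: "0 \<le> b" "b \<le> pi" "Q = rot_z a ** rot_y b"
    by (auto simp: euler_angles_def rot_z_0)
  then have eq: "cos b = cos \<beta>" "sin b * cos a = sin \<beta> * cos \<alpha>" "sin b * sin a = sin \<beta> * sin \<alpha>"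
  proof -
    have "vector [sin b * cos a, sin b * sin a, cos b] =
        (vector [sin \<beta> * cos \<alpha>, sin \<beta> * sin \<alpha>, cos \<beta>] :: real^3)"
      using Q unfolding ab(3) rot_zy_north_pole by blast
    then show "cos b = cos \<beta>" "sin b * cos a = sin \<beta> * cos \<alpha>" "sin b * sin a = sin \<beta> * sin \<alpha>"
      by (simp_all add: vec_eq_iff forall_3)
  qed
  have "b = \<beta>" using eq(1) ab assms by (simp add: cos_inj_pi)
  moreover from this eq assms have "cos a = cos \<alpha>" "sin a = sin \<alpha>" by auto
  ultimately show "Q = rot_z \<alpha> ** rot_y \<beta>"
    using ab by (simp add: rot_z_def)
qed

text \<open>All that the main argument needs about \<open>g\<close>. The rotation about the y axis
  leaves the second basis vector fixed, so only the longitude acts on it and turns it into the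
  direction of the parallel.\<close>

lemma g_properties:
  assumes "y \<in> U_e"
  shows "rotation_matrix (g y)" "g y *v axis 3 1 = y" "g y *v axis 2 1 = rho_e y"
proof -
  obtain \<alpha> \<beta> where *: "0 \<le> \<alpha>" "\<alpha> < 2 * pi" "0 \<le> \<beta>" "\<beta> \<le> pi" "sin \<beta> > 0"
    and y: "y = vector [sin \<beta> * cos \<alpha>, sin \<beta> * sin \<alpha>, cos \<beta>]"
    using U_e_spherical_coordinates[OF assms] .
  have g: "g y = rot_z \<alpha> ** rot_y \<beta>"
    using g_spherical_coordinates[OF *] y by simp
  show "rotation_matrix (g y)" "g y *v axis 3 1 = y"
    unfolding g north_pole_eq_axis[symmetric]
    by (simp_all add: rotation_matrix_mul rotation_rot_z rotation_rot_y rot_zy_north_pole flip: y)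
  \<comment> \<open>The normalising factor in \<open>rho_e\<close> is
    \<open>1 / sin \<beta>\<close>, with no absolute value because the sine is positive.\<close>
  have "(y$1)\<^sup>2 + (y$2)\<^sup>2 = (sin \<beta>)\<^sup>2"
    using y by (simp add: power_mult_distrib flip: distrib_left)
  then have "sqrt ((y$1)\<^sup>2 + (y$2)\<^sup>2) = sin \<beta>"
    using * by simp
  then show "g y *v axis 2 1 = rho_e y"
    using * y by (simp add: g rho_e_def rot_zy_axis_2 vec_eq_iff forall_3)
qed

section \<open>Rotations about the z axis and oriented angles\<close>

lemma rotation_matrix_fixing_axis_3:
  assumes Q: "rotation_matrix Q" and fix3: "Q *v axis 3 1 = axis 3 1"
  obtains a where "0 \<le> a" "a < 2 * pi" "Q = rot_z a"
proof -
  have orth: "orthogonal_transformation ((*v) Q)"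
    using Q by (simp add: rotation_matrix_def orthogonal_transformation_matrix)
  \<comment> \<open>The first column of \<open>Q\<close> is a unit vector orthogonal to the fixed
    third axis, so it lies on the unit circle of the xy-plane and determines
    \<open>a\<close>.\<close>
  define u where "u = Q *v axis 1 1"
  have "u \<bullet> axis 3 1 = axis 1 1 \<bullet> (axis 3 1 :: real^3)"
    using orth fix3 unfolding u_def orthogonal_transformation_def by metis
  then have u3: "u$3 = 0"
    by (simp add: inner_axis) (simp add: axis_def)
  have "u \<bullet> u = axis 1 1 \<bullet> (axis 1 1 :: real^3)"
    using orth unfolding u_def orthogonal_transformation_def by metis
  then have "(u$1)\<^sup>2 + (u$2)\<^sup>2 = 1"
    using u3 by (simp add: inner_vec_def sum_3 inner_axis_axis axis_def power2_eq_square)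
  then obtain a where a: "0 \<le> a" "a < 2 * pi" "u$1 = cos a" "u$2 = sin a"
    by (rule sincos_total_2pi)
  \<comment> \<open>Rotations preserve cross products, so the second column is forced by the other
    two.\<close>
  have "Q *v axis 2 1 = axis 3 1 \<times> u"
    using cross_rotation_matrix[OF Q, of "axis 3 1" "axis 1 1"]
    by (simp add: fix3 u_def cross_basis)
  then have Q2: "Q *v axis 2 1 = vector [- sin a, cos a, 0]"
    using a u3 by (simp add: vec_eq_iff forall_3 cross3_def axis_def)
  have col: "Q$i$j = (Q *v axis j 1)$i" for i j
    by (simp add: matrix_vector_mul_component inner_axis)
  have "Q$i$1 = u$i" "Q$i$2 = (vector [- sin a, cos a, 0] :: real^3)$i" "Q$i$3 = axis 3 1$i" for i
    by (simp_all only: col u_def Q2 fix3)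
  then have "Q = rot_z a"
    using a u3 by (simp add: vec_eq_iff forall_3 rot_z_def) (simp add: axis_def)
  with that a show ?thesis by blast
qed

lemma angle_eqI:
  fixes a b :: real
  assumes "a \<in> {0..<2 * pi}" "b \<in> {0..<2 * pi}" "cos a = cos b" "sin a = sin b"
  shows "a = b"
proof -
  have "[a = b] (rmod (2 * pi))"
    using assms by (simp add: complex_eq_iff flip: cis_eq_iff)
  with assms show ?thesis by (simp add: rcong_def)
qed

lemma z_rotation_angle_rot_z:
  assumes "0 \<le> a" "a < 2 * pi"
  shows "z_rotation_angle (rot_z a) = a"
  unfolding z_rotation_angle_def
proof (rule the_equality)
  fix b assume b: "b \<in> {0..<2 * pi} \<and> rot_z a = rot_z b"
  then have "rot_z a $ 1 $ 1 = rot_z b $ 1 $ 1" "rot_z a $ 2 $ 1 = rot_z b $ 2 $ 1"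
    by simp_all
  then have "cos b = cos a" "sin b = sin a"
    by (simp_all add: rot_z_def)
  with b assms show "b = a"
    using angle_eqI[of b a] by simp
qed (use assms in simp)

text \<open>The vectors \<open>u\<close> and \<open>n \<times> u\<close> are orthonormal, so inner
  products with \<open>v\<close> recover the cosine and sine of the angle. Since \<open>a\<close>
  may be any real, the angle is its representative in \<open>[0, 2 pi)\<close>.\<close>

lemma oriented_angle_rcong:
  assumes "norm u = 1" "norm v = 1" "norm n = 1" "u \<bullet> n = 0"
    and v: "v = cos a *\<^sub>R u + sin a *\<^sub>R (n \<times> u)"
  shows "[oriented_angle n u v = a] (rmod (2 * pi))"
proof -
  have sgn: "sgn u = u" "sgn v = v" using assms by (simp_all add: sgn_div_norm)
  have inner: "u \<bullet> u = 1" "u \<bullet> (n \<times> u) = 0" "(n \<times> u) \<bullet> (n \<times> u) = 1"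
    using assms norm_cross_dot[of n u]
    by (simp_all add: dot_cross_self inner_commute flip: power2_norm_eq_inner)
  have "oriented_angle n u v = a rmod (2 * pi)"
    unfolding oriented_angle_def sgn
  proof (rule the_equality)
    show "a rmod (2 * pi) \<in> {0..<2 * pi} \<and>
      v = cos (a rmod (2 * pi)) *\<^sub>R u + sin (a rmod (2 * pi)) *\<^sub>R (n \<times> u)"
      using v by (simp add: rmod_nonneg rmod_less)
  next
    fix b assume b: "b \<in> {0..<2 * pi} \<and> v = cos b *\<^sub>R u + sin b *\<^sub>R (n \<times> u)"
    have "v \<bullet> u = cos c" "v \<bullet> (n \<times> u) = sin c" if "v = cos c *\<^sub>R u + sin c *\<^sub>R (n \<times> u)" for c
      using inner by (simp_all add: that inner_add_left inner_commute[of "n \<times> u" u])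
    with b v have "cos b = cos a" "sin b = sin a" by metis+
    with b show "b = a rmod (2 * pi)"
      using angle_eqI[of b "a rmod (2 * pi)"] by (simp add: rmod_nonneg rmod_less)
  qed
  then show ?thesis by (simp add: rcong_def)
qed

section \<open>Comparison of the two frames at \<open>x\<close>\<close>

theorem lemma9p4p2:
  fixes R1 R2 :: "real^3^3" and x :: "real^3"
  assumes "rotation_matrix R1" and "rotation_matrix R2"
    and "x \<in> U R1 \<inter> U R2"
  shows "[\<omega> R2 R1 x = - \<psi> R2 R1 x] (rmod (2 * pi))"
proof -
  define frame where "frame R = R ** g (matrix_inv R *v x)" for R
  have frame: "rotation_matrix (frame R)" "frame R *v axis 3 1 = x" "frame R *v axis 2 1 = rho R x"
    if R: "rotation_matrix R" and x: "x \<in> U R" for R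
    using g_properties[OF matrix_inv_rotation_U(1)[OF that]] matrix_inv_rotation_U(2)[OF that] R
    by (simp_all add: frame_def rho_def rotation_matrix_mul flip: matrix_vector_mul_assoc)
  note frame1 = frame[OF assms(1) IntD1[OF assms(3)]]
  note frame2 = frame[OF assms(2) IntD2[OF assms(3)]]
  define Q where "Q = transpose (frame R2) ** frame R1"
  have "orthogonal_matrix (g (matrix_inv R2 *v x))"
    using g_properties(1)[OF matrix_inv_rotation_U(1)] assms by (simp add: rotation_matrix_def)
  then have k: "k R2 R1 x = Q"
    using assms by (simp add: k_def Q_def frame_def matrix_inv_orthogonal rotation_matrix_def
        matrix_transpose_mul matrix_mul_assoc)
  have orth2: "orthogonal_matrix (frame R2)"
    using frame2 by (simp add: rotation_matrix_def)
  \<comment> \<open>Both frames send the third axis to \<open>x\<close>, so on that axis one may be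
    exchanged for the other.\<close>
  have "Q *v axis 3 1 = (transpose (frame R2) ** frame R2) *v axis 3 1"
    using frame1 frame2 by (simp add: Q_def flip: matrix_vector_mul_assoc)
  then have "Q *v axis 3 1 = axis 3 1"
    using orth2 by (simp add: orthogonal_matrix_def)
  moreover have "rotation_matrix Q"
    using frame1 frame2 by (simp add: Q_def rotation_matrix_mul rotation_matrix_transpose)
  ultimately obtain w where w: "0 \<le> w" "w < 2 * pi" "Q = rot_z w"
    using rotation_matrix_fixing_axis_3 by blast
  then have omega: "\<omega> R2 R1 x = w"
    by (simp add: \<omega>_def k z_rotation_angle_rot_z)
  \<comment> \<open>The minus sign of the theorem arises here: \<open>Q\<close> expresses the first
    frame through the second, whereas \<psi> measures from the first to the second.\<close>
  have "frame R1 ** rot_z (-w) = frame R2"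
  proof -
    have "frame R1 = frame R2 ** rot_z w"
      using orth2 by (simp add: Q_def orthogonal_matrix_def matrix_mul_assoc flip: w(3))
    moreover have "rot_z w ** rot_z (-w) = mat 1"
      by (simp add: vec_eq_iff forall_3 rot_z_def matrix_matrix_mult_def mat_def sum_3
          flip: power2_eq_square)
    ultimately show ?thesis by (simp flip: matrix_mul_assoc)
  qed
  \<comment> \<open>Written with a cross product, the turned vector has a form that
    \<open>frame R1\<close> carries over to the tangent plane at \<open>x\<close>.\<close>
  moreover have "rot_z (-w) *v axis 2 1 = cos (-w) *\<^sub>R axis 2 1 + sin (-w) *\<^sub>R (axis 3 1 \<times> axis 2 1)"
    by (simp add: vec_eq_iff forall_3 rot_z_def matrix_vector_mult_def axis_def sum_3 cross3_def)
  ultimately have "frame R2 *v axis 2 1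
      = frame R1 *v (cos (-w) *\<^sub>R axis 2 1 + sin (-w) *\<^sub>R (axis 3 1 \<times> axis 2 1))"
    by (metis matrix_vector_mul_assoc)
  also have "\<dots> = cos (-w) *\<^sub>R (frame R1 *v axis 2 1)
      + sin (-w) *\<^sub>R ((frame R1 *v axis 3 1) \<times> (frame R1 *v axis 2 1))"
    by (simp only: cross_rotation_matrix[OF frame1(1)] matrix_vector_right_distrib matrix_vector_mult_scaleR)
  finally have rho2: "rho R2 x = cos (-w) *\<^sub>R rho R1 x + sin (-w) *\<^sub>R (x \<times> rho R1 x)"
    using frame1 frame2 by simp
  have orth: "orthogonal_transformation ((*v) (frame R1))" "orthogonal_transformation ((*v) (frame R2))"
    using frame1 frame2 by (simp_all add: rotation_matrix_def orthogonal_transformation_matrix)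
  have "norm x = 1" "norm (rho R1 x) = 1" "norm (rho R2 x) = 1" "rho R1 x \<bullet> x = 0"
  proof -
    show "norm x = 1" "norm (rho R1 x) = 1" "norm (rho R2 x) = 1"
      using orthogonal_transformation_norm[OF orth(1), of "axis 3 1"]
        orthogonal_transformation_norm[OF orth(1), of "axis 2 1"]
        orthogonal_transformation_norm[OF orth(2), of "axis 2 1"]
      by (simp_all add: frame1 frame2)
    have "(frame R1 *v axis 2 1) \<bullet> (frame R1 *v axis 3 1) = axis 2 1 \<bullet> (axis 3 1 :: real^3)"
      using orth(1) by (simp add: orthogonal_transformation_def)
    then have "rho R1 x \<bullet> x = axis 2 1 \<bullet> (axis 3 1 :: real^3)"
      by (simp add: frame1)
    then show "rho R1 x \<bullet> x = 0" by (simp add: inner_axis_axis)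
  qed
  \<comment> \<open>For nonzero \<open>w\<close> the angle \<open>-w\<close> lies outside
    \<open>[0, 2 pi)\<close>, hence a congruence.\<close>
  then have "[\<psi> R2 R1 x = - w] (rmod (2 * pi))"
    unfolding \<psi>_def using rho2 by (intro oriented_angle_rcong)
  then show ?thesis
    unfolding omega by (metis rcong_sym rcong_uminus_left_iff)
qed

end
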